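(* Let $i\in\mathcal S$ be the initial regime and let the standing assumptions on the coefficients (given in the context) hold. If $0<\gamma_1\le\gamma_2$, then the open-loop upper values at zero initial time and zero initial state satisfy $$\overline V^0_{\gamma_2}(0,0,i)\le \overline V^0_{\gamma_1}(0,0,i).$$
   Context: Let $T\in(0,\infty)$. On a complete probability space $(\Omega,\mathcal F,\mathbb P)$ let $W,\overline W$ be independent one-dimensional standard Brownian motions and let $\alpha$ be a continuous-time homogeneous irreducible Markov chain, independent of $(W,\overline W)$, with finite state space $\mathcal S=\{1,\dots,D\}$ and generator $(\lambda_{ij})_{i,j=1}^D$, $\lambda_{ij}>0$ for $i\ne j$, $\sum_j\lambda_{ij}=0$. $\mathbb F=\{\mathcal F_t\}$ is the filtration generated by $(W,\overline W,\alpha)$ and $\mathbb G=\{\mathcal G_t\}$ the filtration generated by $(W,\alpha)$, both augmented by the $\mathbb P$-null sets. $L^2_{\mathbb F}(0,T;\mathbb R^k)$ (resp. $L^2_{\mathbb G}(0,T;\mathbb R^k)$) is the set of $\mathbb F$- (resp. $\mathbb G$-) progressively measurable $\mathbb R^k$-valued processes $\phi$ with $\mathbb E\int_0^T|\phi(s)|^2ds<\infty$. $\mathbb S^n$ is the set of real symmetric $n\times n$ matrices. $M\gg0$ means $M\ge\delta I$ for some constant $\delta>0$ (uniformly in a.e. $s$). Coefficients (deterministic, for each $j\in\mathcal S$): $A(\cdot,j)\in L^1(0,T;\mathbb R^{n\times n})$; $C(\cdot,j),\bar C(\cdot,j)\in L^2(0,T;\mathbb R^{n\times n})$; $B=(B_1\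 B_2)$ with $B(\cdot,j)\in L^2(0,T;\mathbb R^{n\times(m+n_v)})$; $D=(D_1\ D_2)$, $\bar D=(\bar D_1\ \bar D_2)$ with $D(\cdot,j),\bar D(\cdot,j)\in L^\infty(0,T;\mathbb R^{n\times(m+n_v)})$; $Q(\cdot,j)\in L^1(0,T;\mathbb S^n)$; $S=\binom{S_1}{S_2}$ with $S(\cdot,j)\in L^2(0,T;\mathbb R^{(m+n_v)\times n})$; $R=\mathrm{diag}(R_1,R_2)$ with $R(\cdot,j)\in L^\infty(0,T;\mathbb S^{m+n_v})$; $G(T,j)\in\mathbb S^n$. The indices $1,2$ refer to the blocks of sizes $m$ and $n_v$. Moreover, for every $j\in\mathcal S$ and a.e. $s\in[0,T]$: $G(T,j)\ge0$, $R(s,j)\gg0$, $Q(s,j)-S(s,j)^\top R(s,j)^{-1}S(s,j)\ge0$. For $u\in L^2_{\mathbb G}(0,T;\mathbb R^m)$ and $v\in L^2_{\mathbb F}(0,T;\mathbb R^{n_v})$ let $x^0$ be the solution (coefficients evaluated at $(s,\alpha(s))$) of $$dx^0=[Ax^0+B_1u+B_2v]ds+[Cx^0+D_1u+D_2v]dW+[\bar Cx^0+\bar D_1u+\bar D_2v]d\overline W,\quad x^0(0)=0,\ \alpha(0)=i,$$ and set $$J^0(0,0,i;u,v)=\mathbb E\Big\{\langle G(T,\alpha(T))x^0(T),x^0(T)\rangle+\int_0^T\big[\langle Qx^0,x^0\rangle+\langle R_1u,u\rangle+\langle R_2v,v\rangle+2\langle S_1x^0,u\rangle+2\langle S_2x^0,v\rangle\big]ds\Big\},$$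 $$J^0_\gamma(0,0,i;u,v)=J^0(0,0,i;u,v)-\gamma^2\,\mathbb E\int_0^T|v(s)|^2ds.$$ The open-loop upper value (an extended real number) is $$\overline V^0_\gamma(0,0,i)=\inf_{u\in L^2_{\mathbb G}(0,T;\mathbb R^m)}\ \sup_{v\in L^2_{\mathbb F}(0,T;\mathbb R^{n_v})}J^0_\gamma(0,0,i;u,v).$$ *)

theory Defs
  imports "HOL-Probability.Probability"
begin

section \<open>Matrices\<close>

text \<open>
  Block matrices are indexed by the sum type: \<open>Inl\<close> is the block of size \<open>m\<close>, \<open>Inr\<close> the block of
  size \<open>n_v\<close>.
\<close>

definition hblock :: "real^'m^'k \<Rightarrow> real^'v^'k \<Rightarrow> real^('m + 'v)^'k" where
  "hblock X Y = (\<chi> i j. case j of Inl a \<Rightarrow> X $ i $ a | Inr b \<Rightarrow> Y $ i $ b)"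

definition vblock :: "real^'k^'m \<Rightarrow> real^'k^'v \<Rightarrow> real^'k^('m + 'v)" where
  "vblock X Y = (\<chi> i. case i of Inl a \<Rightarrow> X $ a | Inr b \<Rightarrow> Y $ b)"

definition diag_block :: "real^'m^'m \<Rightarrow> real^'v^'v \<Rightarrow> real^('m + 'v)^('m + 'v)" where
  "diag_block X Y = vblock (hblock X 0) (hblock 0 Y)"

definition symmetric_mat :: "real^'k^'k \<Rightarrow> bool" where
  "symmetric_mat X \<longleftrightarrow> transpose X = X"

definition psd_mat :: "real^'k^'k \<Rightarrow> bool" where
  "psd_mat X \<longleftrightarrow> symmetric_mat X \<and> (\<forall>z. 0 \<le> z \<bullet> (X *v z))"


section \<open>Deterministic Lebesgue spaces on the time interval\<close>

definition L1_time :: "real \<Rightarrow> (real \<Rightarrow> 'b::euclidean_space) set" where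
  "L1_time T = {f. set_integrable lebesgue {0..T} f}"

definition L2_time :: "real \<Rightarrow> (real \<Rightarrow> 'b::euclidean_space) set" where
  "L2_time T = {f. set_borel_measurable lebesgue {0..T} f \<and>
                   set_integrable lebesgue {0..T} (\<lambda>s. (norm (f s))\<^sup>2)}"

definition Linf_time :: "real \<Rightarrow> (real \<Rightarrow> 'b::euclidean_space) set" where
  "Linf_time T = {f. set_borel_measurable lebesgue {0..T} f \<and>
                     (\<exists>K. AE s in lebesgue. s \<in> {0..T} \<longrightarrow> norm (f s) \<le> K)}"


section \<open>Brownian motions, the regime process and the filtrations\<close>

definition brownian_motion :: "'a measure \<Rightarrow> (real \<Rightarrow> 'a \<Rightarrow> real) \<Rightarrow> bool" where
  "brownian_motion M W \<longleftrightarrow>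
     (\<forall>t\<ge>0. W t \<in> borel_measurable M) \<and>
     (AE \<omega> in M. W 0 \<omega> = 0) \<and>
     (\<forall>s t. 0 \<le> s \<and> s < t \<longrightarrow>
        distributed M lborel (\<lambda>\<omega>. W t \<omega> - W s \<omega>) (normal_density 0 (sqrt (t - s)))) \<and>
     (\<forall>(k::nat) (\<tau>::nat \<Rightarrow> real). 0 \<le> \<tau> 0 \<and> (\<forall>l<k. \<tau> l \<le> \<tau> (Suc l)) \<longrightarrow>
        prob_space.indep_vars M (\<lambda>_. borel) (\<lambda>l \<omega>. W (\<tau> (Suc l)) \<omega> - W (\<tau> l) \<omega>) {..<k}) \<and>
     (AE \<omega> in M. continuous_on {0..} (\<lambda>t. W t \<omega>))"

text \<open>
  \<open>transition_semigroup S lam p\<close>: \<open>p\<close> is the family of transition matrices of a homogeneous chain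
  on \<open>S\<close>, and \<open>lam\<close> is its generator, the derivative of \<open>p\<close> at time \<open>0\<close>.
\<close>

definition transition_semigroup ::
  "nat set \<Rightarrow> (nat \<Rightarrow> nat \<Rightarrow> real) \<Rightarrow> (real \<Rightarrow> nat \<Rightarrow> nat \<Rightarrow> real) \<Rightarrow> bool" where
  "transition_semigroup S lam p \<longleftrightarrow>
     (\<forall>t\<ge>0. \<forall>i\<in>S. (\<forall>j\<in>S. 0 \<le> p t i j) \<and> (\<Sum>j\<in>S. p t i j) = 1) \<and>
     (\<forall>i\<in>S. \<forall>j\<in>S. p 0 i j = of_bool (i = j)) \<and>
     (\<forall>s\<ge>0. \<forall>t\<ge>0. \<forall>i\<in>S. \<forall>j\<in>S. p (s + t) i j = (\<Sum>l\<in>S. p s i l * p t l j)) \<and>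
     (\<forall>i\<in>S. \<forall>j\<in>S. ((\<lambda>t. p t i j) has_real_derivative lam i j) (at_right 0))"

text \<open>
  Continuous-time homogeneous irreducible Markov chain with finite state space \<open>S\<close> and generator
  \<open>lam\<close>, with cadlag paths. The Markov property is expressed by the finite-dimensional
  distributions.
\<close>

definition markov_chain ::
  "'a measure \<Rightarrow> nat set \<Rightarrow> (nat \<Rightarrow> nat \<Rightarrow> real) \<Rightarrow> (real \<Rightarrow> 'a \<Rightarrow> nat) \<Rightarrow> bool" where
  "markov_chain M S lam \<alpha> \<longleftrightarrow>
     (\<forall>t\<ge>0. \<alpha> t \<in> M \<rightarrow>\<^sub>M count_space UNIV) \<and>
     (\<forall>t\<ge>0. \<forall>\<omega>\<in>space M. \<alpha> t \<omega> \<in> S) \<and>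
     (AE \<omega> in M. (\<forall>t\<ge>0. eventually (\<lambda>s. \<alpha> s \<omega> = \<alpha> t \<omega>) (at_right t)) \<and>
                 (\<forall>t>0. \<exists>j. eventually (\<lambda>s. \<alpha> s \<omega> = j) (at_left t))) \<and>
     (\<exists>p. transition_semigroup S lam p \<and>
        (\<forall>i\<in>S. \<forall>j\<in>S. \<exists>t>0. 0 < p t i j) \<and>
        (\<forall>(k::nat) (\<tau>::nat \<Rightarrow> real) (a::nat \<Rightarrow> nat).
           0 \<le> \<tau> 0 \<and> (\<forall>l<k. \<tau> l < \<tau> (Suc l)) \<and> (\<forall>l\<le>k. a l \<in> S) \<longrightarrow>
           measure M {\<omega> \<in> space M. \<forall>l\<le>k. \<alpha> (\<tau> l) \<omega> = a l} =
             measure M {\<omega> \<in> space M. \<alpha> (\<tau> 0) \<omega> = a 0} *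
             (\<Prod>l<k. p (\<tau> (Suc l) - \<tau> l) (a l) (a (Suc l)))))"

definition process_events ::
  "'a measure \<Rightarrow> 'b measure \<Rightarrow> real set \<Rightarrow> (real \<Rightarrow> 'a \<Rightarrow> 'b) \<Rightarrow> 'a set set" where
  "process_events M N I X = (\<Union>s\<in>I. sets (vimage_algebra (space M) (X s) N))"

definition filtration_F ::
  "'a measure \<Rightarrow> (real \<Rightarrow> 'a \<Rightarrow> real) \<Rightarrow> (real \<Rightarrow> 'a \<Rightarrow> real) \<Rightarrow> (real \<Rightarrow> 'a \<Rightarrow> nat)
   \<Rightarrow> real \<Rightarrow> 'a measure" where
  "filtration_F M W Wb \<alpha> t = sigma (space M)
     (process_events M borel {0..t} W \<union> process_events M borel {0..t} Wb \<union>
      process_events M (count_space UNIV) {0..t} \<alpha> \<union> null_sets M)"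

definition filtration_G ::
  "'a measure \<Rightarrow> (real \<Rightarrow> 'a \<Rightarrow> real) \<Rightarrow> (real \<Rightarrow> 'a \<Rightarrow> nat) \<Rightarrow> real \<Rightarrow> 'a measure" where
  "filtration_G M W \<alpha> t = sigma (space M)
     (process_events M borel {0..t} W \<union>
      process_events M (count_space UNIV) {0..t} \<alpha> \<union> null_sets M)"

text \<open>The state space is \<open>{1..d}\<close>.\<close>

definition stochastic_basis ::
  "'a measure \<Rightarrow> (real \<Rightarrow> 'a \<Rightarrow> real) \<Rightarrow> (real \<Rightarrow> 'a \<Rightarrow> real) \<Rightarrow> (real \<Rightarrow> 'a \<Rightarrow> nat)
   \<Rightarrow> nat \<Rightarrow> (nat \<Rightarrow> nat \<Rightarrow> real) \<Rightarrow> bool" where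
  "stochastic_basis M W Wb \<alpha> d lam \<longleftrightarrow>
     prob_space M \<and> complete_measure M \<and>
     brownian_motion M W \<and> brownian_motion M Wb \<and>
     (\<forall>i\<in>{1..d}. \<forall>j\<in>{1..d}. i \<noteq> j \<longrightarrow> 0 < lam i j) \<and>
     (\<forall>i\<in>{1..d}. (\<Sum>j\<in>{1..d}. lam i j) = 0) \<and>
     markov_chain M {1..d} lam \<alpha> \<and>
     prob_space.indep_set M
       (sigma_sets (space M) (process_events M borel {0..} W))
       (sigma_sets (space M) (process_events M borel {0..} Wb)) \<and>
     prob_space.indep_set M
       (sigma_sets (space M) (process_events M (count_space UNIV) {0..} \<alpha>))
       (sigma_sets (space M) (process_events M borel {0..} W \<union> process_events M borel {0..} Wb))"


section \<open>Progressively measurable processes\<close>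

definition prog_measurable ::
  "(real \<Rightarrow> 'a measure) \<Rightarrow> real \<Rightarrow> (real \<Rightarrow> 'a \<Rightarrow> 'b::euclidean_space) \<Rightarrow> bool" where
  "prog_measurable F T \<phi> \<longleftrightarrow>
     (\<forall>t\<in>{0..T}. (\<lambda>(s, \<omega>). \<phi> s \<omega>) \<in> borel_measurable (restrict_space borel {0..t} \<Otimes>\<^sub>M F t))"

definition L2_process ::
  "'a measure \<Rightarrow> (real \<Rightarrow> 'a measure) \<Rightarrow> real \<Rightarrow> (real \<Rightarrow> 'a \<Rightarrow> 'b::euclidean_space) set" where
  "L2_process M F T = {\<phi>. prog_measurable F T \<phi> \<and>
     (\<integral>\<^sup>+\<omega>. (\<integral>\<^sup>+s\<in>{0..T}. ennreal ((norm (\<phi> s \<omega>))\<^sup>2) \<partial>lebesgue) \<partial>M) < \<infinity>}"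


section \<open>The Ito integral\<close>

text \<open>
  The data \<open>(N, \<tau>, \<xi>)\<close> represent the simple process that equals \<open>\<xi> k\<close> on \<open>(\<tau> k, \<tau> (k+1)]\<close> for
  \<open>k < N\<close> and vanishes elsewhere.
\<close>

definition simple_data ::
  "'a measure \<Rightarrow> (real \<Rightarrow> 'a measure) \<Rightarrow> real \<Rightarrow> nat \<Rightarrow> (nat \<Rightarrow> real)
   \<Rightarrow> (nat \<Rightarrow> 'a \<Rightarrow> 'b::euclidean_space) \<Rightarrow> bool" where
  "simple_data M F T N \<tau> \<xi> \<longleftrightarrow>
     (\<forall>k\<le>N. \<tau> k \<in> {0..T}) \<and> (\<forall>k<N. \<tau> k \<le> \<tau> (Suc k)) \<and>
     (\<forall>k<N. \<xi> k \<in> borel_measurable (F (\<tau> k)) \<and> (\<exists>K. \<forall>\<omega>\<in>space M. norm (\<xi> k \<omega>) \<le> K))"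

definition simple_process ::
  "nat \<Rightarrow> (nat \<Rightarrow> real) \<Rightarrow> (nat \<Rightarrow> 'a \<Rightarrow> 'b::euclidean_space) \<Rightarrow> real \<Rightarrow> 'a \<Rightarrow> 'b" where
  "simple_process N \<tau> \<xi> s \<omega> = (\<Sum>k<N. indicator {\<tau> k<..\<tau> (Suc k)} s *\<^sub>R \<xi> k \<omega>)"

definition simple_integral ::
  "(real \<Rightarrow> 'a \<Rightarrow> real) \<Rightarrow> nat \<Rightarrow> (nat \<Rightarrow> real) \<Rightarrow> (nat \<Rightarrow> 'a \<Rightarrow> 'b::euclidean_space)
   \<Rightarrow> real \<Rightarrow> 'a \<Rightarrow> 'b" where
  "simple_integral W N \<tau> \<xi> t \<omega> =
     (\<Sum>k<N. (W (min t (\<tau> (Suc k))) \<omega> - W (min t (\<tau> k)) \<omega>) *\<^sub>R \<xi> k \<omega>)"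

text \<open>
  \<open>ito_integral M F T W H I\<close>: the process \<open>I t\<close> is (a version of) the integral of \<open>H\<close> against
  \<open>W\<close> over \<open>[0,t]\<close>, for all \<open>t \<in> [0,T]\<close>, obtained as the mean-square limit of integrals of simple
  processes converging to \<open>H\<close> in \<open>L2(\<Omega> \<times> [0,T])\<close>.
\<close>

definition ito_integral ::
  "'a measure \<Rightarrow> (real \<Rightarrow> 'a measure) \<Rightarrow> real \<Rightarrow> (real \<Rightarrow> 'a \<Rightarrow> real)
   \<Rightarrow> (real \<Rightarrow> 'a \<Rightarrow> 'b::euclidean_space) \<Rightarrow> (real \<Rightarrow> 'a \<Rightarrow> 'b) \<Rightarrow> bool" where
  "ito_integral M F T W H I \<longleftrightarrow>
     (\<forall>t\<in>{0..T}. I t \<in> borel_measurable (F t)) \<and>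
     (\<exists>(N::nat \<Rightarrow> nat) (\<tau>::nat \<Rightarrow> nat \<Rightarrow> real) (\<xi>::nat \<Rightarrow> nat \<Rightarrow> 'a \<Rightarrow> 'b).
        (\<forall>l. simple_data M F T (N l) (\<tau> l) (\<xi> l)) \<and>
        (\<lambda>l. \<integral>\<^sup>+\<omega>. (\<integral>\<^sup>+s\<in>{0..T}.
               ennreal ((norm (H s \<omega> - simple_process (N l) (\<tau> l) (\<xi> l) s \<omega>))\<^sup>2) \<partial>lebesgue) \<partial>M)
          \<longlonglongrightarrow> 0 \<and>
        (\<forall>t\<in>{0..T}.
          (\<lambda>l. \<integral>\<^sup>+\<omega>. ennreal ((norm (I t \<omega> - simple_integral W (N l) (\<tau> l) (\<xi> l) t \<omega>))\<^sup>2) \<partial>M)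
            \<longlonglongrightarrow> 0))"


section \<open>The linear-quadratic problem\<close>

text \<open>
  The coefficients at time \<open>s\<close> and regime \<open>j\<close>; \<open>cCb\<close>, \<open>cDb1\<close>, \<open>cDb2\<close> are the coefficients
  written with a bar, those of the second Brownian motion.
\<close>

record ('n, 'm, 'v) lq_coeffs =
  cA :: "real \<Rightarrow> nat \<Rightarrow> real^('n::finite)^'n"
  cC :: "real \<Rightarrow> nat \<Rightarrow> real^'n^'n"
  cCb :: "real \<Rightarrow> nat \<Rightarrow> real^'n^'n"
  cB1 :: "real \<Rightarrow> nat \<Rightarrow> real^('m::finite)^'n"
  cB2 :: "real \<Rightarrow> nat \<Rightarrow> real^('v::finite)^'n"
  cD1 :: "real \<Rightarrow> nat \<Rightarrow> real^'m^'n"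
  cD2 :: "real \<Rightarrow> nat \<Rightarrow> real^'v^'n"
  cDb1 :: "real \<Rightarrow> nat \<Rightarrow> real^'m^'n"
  cDb2 :: "real \<Rightarrow> nat \<Rightarrow> real^'v^'n"
  cQ :: "real \<Rightarrow> nat \<Rightarrow> real^'n^'n"
  cS1 :: "real \<Rightarrow> nat \<Rightarrow> real^'n^'m"
  cS2 :: "real \<Rightarrow> nat \<Rightarrow> real^'n^'v"
  cR1 :: "real \<Rightarrow> nat \<Rightarrow> real^'m^'m"
  cR2 :: "real \<Rightarrow> nat \<Rightarrow> real^'v^'v"
  cG :: "nat \<Rightarrow> real^'n^'n"

definition coeff_S ::
  "('n::finite, 'm::finite, 'v::finite) lq_coeffs \<Rightarrow> real \<Rightarrow> nat \<Rightarrow> real^'n^('m + 'v)" where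
  "coeff_S c s j = vblock (cS1 c s j) (cS2 c s j)"

definition coeff_R ::
  "('n::finite, 'm::finite, 'v::finite) lq_coeffs \<Rightarrow> real \<Rightarrow> nat \<Rightarrow> real^('m + 'v)^('m + 'v)" where
  "coeff_R c s j = diag_block (cR1 c s j) (cR2 c s j)"

definition standing_assumptions ::
  "real \<Rightarrow> nat \<Rightarrow> ('n::finite, 'm::finite, 'v::finite) lq_coeffs \<Rightarrow> bool" where
  "standing_assumptions T d c \<longleftrightarrow> (\<forall>j\<in>{1..d}.
     (\<lambda>s. cA c s j) \<in> L1_time T \<and>
     (\<lambda>s. cC c s j) \<in> L2_time T \<and>
     (\<lambda>s. cCb c s j) \<in> L2_time T \<and>
     (\<lambda>s. hblock (cB1 c s j) (cB2 c s j)) \<in> L2_time T \<and>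
     (\<lambda>s. hblock (cD1 c s j) (cD2 c s j)) \<in> Linf_time T \<and>
     (\<lambda>s. hblock (cDb1 c s j) (cDb2 c s j)) \<in> Linf_time T \<and>
     (\<lambda>s. cQ c s j) \<in> L1_time T \<and>
     (AE s in lebesgue. s \<in> {0..T} \<longrightarrow> symmetric_mat (cQ c s j)) \<and>
     (\<lambda>s. coeff_S c s j) \<in> L2_time T \<and>
     (\<lambda>s. coeff_R c s j) \<in> Linf_time T \<and>
     (AE s in lebesgue. s \<in> {0..T} \<longrightarrow> symmetric_mat (coeff_R c s j)) \<and>
     psd_mat (cG c j) \<and>
     (\<exists>\<delta>>0. AE s in lebesgue. s \<in> {0..T} \<longrightarrow> psd_mat (coeff_R c s j - \<delta> *\<^sub>R mat 1)) \<and>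
     (AE s in lebesgue. s \<in> {0..T} \<longrightarrow>
        psd_mat (cQ c s j - transpose (coeff_S c s j) ** matrix_inv (coeff_R c s j) ** coeff_S c s j)))"

text \<open>
  \<open>x\<close> is a continuous adapted square-integrable solution of the state equation with
  \<open>x(0) = 0\<close>, \<open>\<alpha>(0) = i\<close>. The time integrals use \<open>lebesgue\<close>, so that the choice of representatives
  of the (Lebesgue measurable) coefficients is irrelevant.
\<close>

definition state_solution ::
  "'a measure \<Rightarrow> (real \<Rightarrow> 'a \<Rightarrow> real) \<Rightarrow> (real \<Rightarrow> 'a \<Rightarrow> real) \<Rightarrow> (real \<Rightarrow> 'a \<Rightarrow> nat) \<Rightarrow> real
   \<Rightarrow> ('n::finite, 'm::finite, 'v::finite) lq_coeffs \<Rightarrow> nat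
   \<Rightarrow> (real \<Rightarrow> 'a \<Rightarrow> real^'m) \<Rightarrow> (real \<Rightarrow> 'a \<Rightarrow> real^'v) \<Rightarrow> (real \<Rightarrow> 'a \<Rightarrow> real^'n) \<Rightarrow> bool" where
  "state_solution M W Wb \<alpha> T c i u v x \<longleftrightarrow>
     (let F = filtration_F M W Wb \<alpha>;
          b = (\<lambda>s \<omega>. cA c s (\<alpha> s \<omega>) *v x s \<omega> + cB1 c s (\<alpha> s \<omega>) *v u s \<omega> + cB2 c s (\<alpha> s \<omega>) *v v s \<omega>);
          \<sigma> = (\<lambda>s \<omega>. cC c s (\<alpha> s \<omega>) *v x s \<omega> + cD1 c s (\<alpha> s \<omega>) *v u s \<omega> + cD2 c s (\<alpha> s \<omega>) *v v s \<omega>);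
          \<sigma>b = (\<lambda>s \<omega>. cCb c s (\<alpha> s \<omega>) *v x s \<omega> + cDb1 c s (\<alpha> s \<omega>) *v u s \<omega> + cDb2 c s (\<alpha> s \<omega>) *v v s \<omega>)
      in prog_measurable F T x \<and>
         (AE \<omega> in M. continuous_on {0..T} (\<lambda>t. x t \<omega>)) \<and>
         (\<integral>\<^sup>+\<omega>. (SUP t\<in>{0..T}. ennreal ((norm (x t \<omega>))\<^sup>2)) \<partial>M) < \<infinity> \<and>
         (AE \<omega> in M. x 0 \<omega> = 0 \<and> \<alpha> 0 \<omega> = i) \<and>
         (AE \<omega> in M. set_integrable lebesgue {0..T} (\<lambda>s. b s \<omega>)) \<and>
         (\<exists>I Ib. ito_integral M F T W \<sigma> I \<and> ito_integral M F T Wb \<sigma>b Ib \<and>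
            (\<forall>t\<in>{0..T}. AE \<omega> in M.
               x t \<omega> = (LINT s:{0..t}|lebesgue. b s \<omega>) + I t \<omega> + Ib t \<omega>)))"

text \<open>
  The solution is unique only up to indistinguishability, which does not affect the cost;
  \<open>state_x0\<close> is an arbitrary version.
\<close>

definition state_x0 ::
  "'a measure \<Rightarrow> (real \<Rightarrow> 'a \<Rightarrow> real) \<Rightarrow> (real \<Rightarrow> 'a \<Rightarrow> real) \<Rightarrow> (real \<Rightarrow> 'a \<Rightarrow> nat) \<Rightarrow> real
   \<Rightarrow> ('n::finite, 'm::finite, 'v::finite) lq_coeffs \<Rightarrow> nat
   \<Rightarrow> (real \<Rightarrow> 'a \<Rightarrow> real^'m) \<Rightarrow> (real \<Rightarrow> 'a \<Rightarrow> real^'v) \<Rightarrow> (real \<Rightarrow> 'a \<Rightarrow> real^'n)" where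
  "state_x0 M W Wb \<alpha> T c i u v = (SOME x. state_solution M W Wb \<alpha> T c i u v x)"

definition cost_J0 ::
  "'a measure \<Rightarrow> (real \<Rightarrow> 'a \<Rightarrow> real) \<Rightarrow> (real \<Rightarrow> 'a \<Rightarrow> real) \<Rightarrow> (real \<Rightarrow> 'a \<Rightarrow> nat) \<Rightarrow> real
   \<Rightarrow> ('n::finite, 'm::finite, 'v::finite) lq_coeffs \<Rightarrow> nat
   \<Rightarrow> (real \<Rightarrow> 'a \<Rightarrow> real^'m) \<Rightarrow> (real \<Rightarrow> 'a \<Rightarrow> real^'v) \<Rightarrow> real" where
  "cost_J0 M W Wb \<alpha> T c i u v =
     (let x = state_x0 M W Wb \<alpha> T c i u v
      in LINT \<omega>|M.
           (cG c (\<alpha> T \<omega>) *v x T \<omega>) \<bullet> x T \<omega> +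
           (LINT s:{0..T}|lebesgue.
              (cQ c s (\<alpha> s \<omega>) *v x s \<omega>) \<bullet> x s \<omega> +
              (cR1 c s (\<alpha> s \<omega>) *v u s \<omega>) \<bullet> u s \<omega> +
              (cR2 c s (\<alpha> s \<omega>) *v v s \<omega>) \<bullet> v s \<omega> +
              2 * ((cS1 c s (\<alpha> s \<omega>) *v x s \<omega>) \<bullet> u s \<omega>) +
              2 * ((cS2 c s (\<alpha> s \<omega>) *v x s \<omega>) \<bullet> v s \<omega>)))"

definition cost_J0_gamma ::
  "'a measure \<Rightarrow> (real \<Rightarrow> 'a \<Rightarrow> real) \<Rightarrow> (real \<Rightarrow> 'a \<Rightarrow> real) \<Rightarrow> (real \<Rightarrow> 'a \<Rightarrow> nat) \<Rightarrow> real
   \<Rightarrow> ('n::finite, 'm::finite, 'v::finite) lq_coeffs \<Rightarrow> real \<Rightarrow> nat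
   \<Rightarrow> (real \<Rightarrow> 'a \<Rightarrow> real^'m) \<Rightarrow> (real \<Rightarrow> 'a \<Rightarrow> real^'v) \<Rightarrow> real" where
  "cost_J0_gamma M W Wb \<alpha> T c \<gamma> i u v =
     cost_J0 M W Wb \<alpha> T c i u v
     - \<gamma>\<^sup>2 * (LINT \<omega>|M. (LINT s:{0..T}|lebesgue. (norm (v s \<omega>))\<^sup>2))"

definition upper_value ::
  "'a measure \<Rightarrow> (real \<Rightarrow> 'a \<Rightarrow> real) \<Rightarrow> (real \<Rightarrow> 'a \<Rightarrow> real) \<Rightarrow> (real \<Rightarrow> 'a \<Rightarrow> nat) \<Rightarrow> real
   \<Rightarrow> ('n::finite, 'm::finite, 'v::finite) lq_coeffs \<Rightarrow> real \<Rightarrow> nat \<Rightarrow> ereal" where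
  "upper_value M W Wb \<alpha> T c \<gamma> i =
     (INF u \<in> L2_process M (filtration_G M W \<alpha>) T.
      SUP v \<in> L2_process M (filtration_F M W Wb \<alpha>) T.
        ereal (cost_J0_gamma M W Wb \<alpha> T c \<gamma> i u v))"

end

theory Submission
  imports Defs
begin

text \<open>The parameter \<gamma> enters only through the penalty
  \<open>- \<gamma>\<^sup>2 * E \<integral> |v|^2\<close>: the state, hence \<open>cost_J0\<close>,
  and both control spaces are free of it. So for each fixed pair (u, v) the cost decreases in
  \<gamma>, and sup over v and inf over u preserve the order.\<close>

lemma cost_J0_gamma_antimono:
  assumes "0 \<le> \<gamma>\<^sub>1" and "\<gamma>\<^sub>1 \<le> \<gamma>\<^sub>2"
  shows "cost_J0_gamma M W Wb \<alpha> T c \<gamma>\<^sub>2 i u v \<le> cost_J0_gamma M W Wb \<alpha> T c \<gamma>\<^sub>1 i u v"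
proof -
  \<comment> \<open>This holds for arbitrary \<open>v\<close>: a Bochner integral whose integrand is
    not integrable is 0.\<close>
  have "0 \<le> (LINT \<omega>|M. (LINT s:{0..T}|lebesgue. (norm (v s \<omega>))\<^sup>2))"
    by (simp add: set_lebesgue_integral_def)
  then show ?thesis
    unfolding cost_J0_gamma_def using assms
    by (simp add: mult_right_mono power_mono)
qed

theorem proposition3p1:
  fixes M :: "'a measure"
    and W Wb :: "real \<Rightarrow> 'a \<Rightarrow> real"
    and \<alpha> :: "real \<Rightarrow> 'a \<Rightarrow> nat"
    and lam :: "nat \<Rightarrow> nat \<Rightarrow> real"
    and c :: "('n::finite, 'm::finite, 'v::finite) lq_coeffs"
    and T \<gamma>\<^sub>1 \<gamma>\<^sub>2 :: real
    and d i :: nat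
  assumes "0 < T"
    and "stochastic_basis M W Wb \<alpha> d lam"
    and "standing_assumptions T d c"
    and "i \<in> {1..d}"
    and "AE \<omega> in M. \<alpha> 0 \<omega> = i"
    and "0 < \<gamma>\<^sub>1" and "\<gamma>\<^sub>1 \<le> \<gamma>\<^sub>2"
  shows "upper_value M W Wb \<alpha> T c \<gamma>\<^sub>2 i \<le> upper_value M W Wb \<alpha> T c \<gamma>\<^sub>1 i"
  unfolding upper_value_def using assms
  \<comment> \<open>Both sides have the same index sets, so the comparison is made at the same
    \<open>u\<close> and \<open>v\<close>; extended real values allow infinite suprema.\<close>
  by (intro INF_mono' SUP_mono') (simp add: cost_J0_gamma_antimono)

end
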